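(* Let $K$ be a finite simplicial complex of $\mathbb{R}^p$ and let $P\subset\mathbb{R}^p$ be the corresponding compact polyhedron $|K|$. Then, for each integer $\nu\geq 1$, there exists a sequence $\{\iota^\nu_n\}_{n\in\mathbb{N}}$ in $\mathcal{S}^\nu(P,P)$ with the following universal property: if $f$ is a real-valued function in $\mathcal{S}^0(P)$ such that $f|_{\sigma}\in\mathcal{S}^\nu(\sigma)$ for each $\sigma\in K$, then the sequence $\{f\circ\iota^\nu_n\}_{n\in\mathbb{N}}$ is contained in $\mathcal{S}^\nu(P)$ and converges to $f$ in $\mathcal{S}^0(P)$. In particular, the sequence $\{\iota^\nu_n\}_{n\in\mathbb{N}}$ converges to the identity map in $\mathcal{S}^0(P,P)$.
   Context: For a finite simplicial complex $K$ of $\mathbb{R}^p$ (its elements are closed simplexes), $|K|=\bigcup_{\sigma\in K}\sigma$ with the topology inherited from $\mathbb{R}^p$. A map between semialgebraic sets is semialgebraic if its graph is a semialgebraic set. For an integer $\nu\ge 0$ and an open semialgebraic set $U\subset\mathbb{R}^m$, $\mathcal{S}^\nu(U)$ is the set of semialgebraic functions $U\to\mathbb{R}$ of class $\mathcal{C}^\nu$. For a semialgebraic set $S\subset\mathbb{R}^m$, $\mathcal{S}^\nu(S)$ is the set of functions $f:S\to\mathbb{R}$ for which there are an open semialgebraic neighborhood $U$ of $S$ in $\mathbb{R}^m$ and $F\in\mathcal{S}^\nu(U)$ with $F|_S=f$. A map $f=(f_1,\dots,f_n):S\to T\subset\mathbb{R}^n$ between semialgebraic sets is $\mathcal{S}^\nu$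 if each $f_i\in\mathcal{S}^\nu(S)$; $\mathcal{S}^\nu(S,T)$ denotes the set of these maps. For $S$ compact, $\mathcal{S}^0(S)$ and $\mathcal{S}^0(S,T)$ are the sets of continuous semialgebraic functions on $S$, respectively continuous semialgebraic maps $S\to T$, endowed with the topology of uniform convergence. *)

theory Defs
  imports "HOL-Analysis.Analysis"
begin

inductive semialgebraic :: "'a::euclidean_space set \<Rightarrow> bool" where
  eq: "real_polynomial_function p \<Longrightarrow> semialgebraic {x. p x = 0}"
| gt: "real_polynomial_function p \<Longrightarrow> semialgebraic {x. p x > 0}"
| compl: "semialgebraic S \<Longrightarrow> semialgebraic (- S)"
| union: "semialgebraic S \<Longrightarrow> semialgebraic T \<Longrightarrow> semialgebraic (S \<union> T)"

text \<open>
  Partial functions \<open>S \<rightarrow> T\<close> are represented by total functions; all notions below depend only on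
  the values on \<open>S\<close>.  In particular graphs are taken over \<open>S\<close> only.
\<close>

definition semialgebraic_on ::
    "'a::euclidean_space set \<Rightarrow> ('a \<Rightarrow> 'b::euclidean_space) \<Rightarrow> bool" where
  "semialgebraic_on S f \<longleftrightarrow> semialgebraic S \<and> semialgebraic ((\<lambda>x. (x, f x)) ` S)"

text \<open>Class \<open>C\<^sup>\<nu>\<close> on \<open>U\<close>, by iterated partial derivatives; meant for open \<open>U\<close> only.\<close>

primrec C_class :: "nat \<Rightarrow> 'a::euclidean_space set \<Rightarrow> ('a \<Rightarrow> real) \<Rightarrow> bool" where
  "C_class 0 U f \<longleftrightarrow> continuous_on U f"
| "C_class (Suc \<nu>) U f \<longleftrightarrow>
     (\<forall>x\<in>U. f differentiable (at x)) \<and>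
     (\<forall>b\<in>Basis. C_class \<nu> U (\<lambda>x. frechet_derivative f (at x) b))"

definition S_open :: "nat \<Rightarrow> 'a::euclidean_space set \<Rightarrow> ('a \<Rightarrow> real) set" where
  "S_open \<nu> U = {F. semialgebraic_on U F \<and> C_class \<nu> U F}"

definition S_fun :: "nat \<Rightarrow> 'a::euclidean_space set \<Rightarrow> ('a \<Rightarrow> real) set" where
  "S_fun \<nu> S = {f. \<exists>U F. open U \<and> semialgebraic U \<and> S \<subseteq> U \<and> F \<in> S_open \<nu> U \<and> (\<forall>x\<in>S. F x = f x)}"

definition S_map ::
    "nat \<Rightarrow> 'a::euclidean_space set \<Rightarrow> 'b::euclidean_space set \<Rightarrow> ('a \<Rightarrow> 'b) set" where
  "S_map \<nu> S T = {f. f ` S \<subseteq> T \<and> (\<forall>b\<in>Basis. (\<lambda>x. f x \<bullet> b) \<in> S_fun \<nu> S)}"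

text \<open>
  For compact \<open>S\<close>, the spaces \<open>\<S>\<^sup>0(S, T)\<close> of continuous semialgebraic maps, without reference to an
  extension to a neighbourhood; \<open>\<S>\<^sup>0(S)\<close> is the case \<open>T = (UNIV :: real set)\<close>.  Convergence is the
  one of the topology of uniform convergence, within this space.
\<close>

definition S0 ::
    "'a::euclidean_space set \<Rightarrow> 'b::euclidean_space set \<Rightarrow> ('a \<Rightarrow> 'b) set" where
  "S0 S T = {f. f ` S \<subseteq> T \<and> continuous_on S f \<and> semialgebraic_on S f}"

definition converges_S0 ::
    "'a::euclidean_space set \<Rightarrow> 'b::euclidean_space set \<Rightarrow> (nat \<Rightarrow> 'a \<Rightarrow> 'b) \<Rightarrow> ('a \<Rightarrow> 'b) \<Rightarrow> bool" where
  "converges_S0 S T g f \<longleftrightarrow>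
     (\<forall>n. g n \<in> S0 S T) \<and> f \<in> S0 S T \<and> uniform_limit S g f sequentially"

end

theory Submission
  imports Defs
begin

text \<open>
  Semialgebraicity of \<open>f \<circ> \<iota>\<close> would in general need the Tarski-Seidenberg theorem.  It is avoided by
  taking \<open>\<iota>\<close> piecewise polynomial, because preimages of semialgebraic sets under such maps are visibly
  semialgebraic.

  Let \<open>W\<close> be an open neighbourhood of \<open>P\<close> and suppose that every point of \<open>W\<close> has a neighbourhood
  that \<open>\<iota> : W \<rightarrow> P\<close> maps into a single simplex \<open>\<sigma> \<in> K\<close>.  If \<open>\<iota>\<close> is of class \<open>C\<^sup>\<nu>\<close>, then so is
  \<open>f \<circ> \<iota>\<close>, because near each point it is the composition of \<open>\<iota>\<close> with a \<open>C\<^sup>\<nu>\<close> extension of \<open>f|\<sigma>\<close>.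

  Such a map is \<open>\<iota> = (\<Sum>i. w\<^sub>i \<pi>\<^sub>i)\<close>, where \<open>\<pi>\<^sub>i\<close> is an affine retraction onto the affine hull of the
  \<open>i\<close>-th simplex \<open>\<tau>\<^sub>i\<close> (simplices being listed by increasing dimension) and the \<open>w\<^sub>i\<close> are a partition of
  unity.  The support of \<open>w\<^sub>i\<close> lies very close to \<open>\<tau>\<^sub>i\<close> and, on a much larger scale, away from the
  simplices listed before it.  Then \<open>\<pi>\<^sub>i\<close> maps the support of \<open>w\<^sub>i\<close> into \<open>\<tau>\<^sub>i\<close>, and the simplices whose
  weights are supported at a given point form a chain of faces, so near that point \<open>\<iota>\<close> takes values
  in the largest of them.
\<close>

section \<open>Semialgebraic sets and piecewise polynomial maps\<close>

lemma semialgebraic_UNIV: "semialgebraic (UNIV :: 'a::euclidean_space set)"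
  using semialgebraic.eq[OF real_polynomial_function.intros(2)[of 0]] by simp

lemma semialgebraic_empty: "semialgebraic ({} :: 'a::euclidean_space set)"
  using semialgebraic.compl[OF semialgebraic_UNIV] by simp

lemma semialgebraic_Int:
  assumes "semialgebraic S" "semialgebraic T"
  shows "semialgebraic (S \<inter> T)"
proof -
  have "S \<inter> T = - (- S \<union> - T)" by blast
  then show ?thesis
    using assms semialgebraic.compl semialgebraic.union by metis
qed

lemma semialgebraic_UN:
  assumes "finite I" "\<And>i. i \<in> I \<Longrightarrow> semialgebraic (A i)"
  shows "semialgebraic (\<Union>i\<in>I. A i)"
  using assms by (induction I rule: finite_induct) (auto intro: semialgebraic_empty semialgebraic.union)

lemma semialgebraic_INT:
  assumes "finite I" "\<And>i. i \<in> I \<Longrightarrow> semialgebraic (A i)"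
  shows "semialgebraic (\<Inter>i\<in>I. A i)"
  using assms by (induction I rule: finite_induct) (auto intro: semialgebraic_UNIV semialgebraic_Int)

text \<open>Preimages commute with the Boolean operations, and a defining polynomial composed with
  \<open>g\<close> is again a polynomial. Working with preimages only keeps projections out of the
  argument.\<close>

lemma semialgebraic_vimage_polynomial:
  assumes "semialgebraic S" "polynomial_function g"
  shows "semialgebraic (g -` S)"
  using assms(1)
proof induction
  case (eq p)
  then have "real_polynomial_function (p \<circ> g)"
    using assms(2) by (rule real_polynomial_function_compose[rotated])
  then show ?case using semialgebraic.eq by (fastforce simp: vimage_def)
next
  case (gt p)
  then have "real_polynomial_function (p \<circ> g)"
    using assms(2) by (rule real_polynomial_function_compose[rotated])
  then show ?case using semialgebraic.gt by (fastforce simp: vimage_def)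
next
  case (compl S)
  then show ?case using semialgebraic.compl by (metis vimage_Compl)
next
  case (union S T)
  then show ?case using semialgebraic.union by (metis vimage_Un)
qed

lemma real_polynomial_function_inner_const: "real_polynomial_function (\<lambda>x. x \<bullet> a)"
  by (intro real_polynomial_function.intros(1) bounded_linear_inner_left)

lemma semialgebraic_zero: "semialgebraic {0 :: 'a::euclidean_space}"
proof -
  have "{0 :: 'a} = (\<Inter>b\<in>Basis. {x. x \<bullet> b = 0})"
    by (auto simp: euclidean_all_zero_iff)
  then show ?thesis
    by (simp add: semialgebraic_INT semialgebraic.eq real_polynomial_function_inner_const)
qed

lemma semialgebraic_box: "semialgebraic (box a (b :: 'a::euclidean_space))"
proof -
  have eq: "box a b = (\<Inter>i\<in>Basis. {x. x \<bullet> i - a \<bullet> i > 0} \<inter> {x. b \<bullet> i - x \<bullet> i > 0})"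
    by (auto simp: box_def)
  show ?thesis
    unfolding eq
    by (intro semialgebraic_INT semialgebraic_Int semialgebraic.gt real_polynomial_function_diff
        real_polynomial_function_inner_const real_polynomial_function.intros(2)) auto
qed

text \<open>The pieces may overlap and continuity is not built in; smoothness is tracked separately
  by \<open>C_class\<close>. Since the pieces cover the whole space, the closure rules below carry
  no conditions on domains.\<close>

definition piecewise_polynomial :: "('a::euclidean_space \<Rightarrow> 'b::euclidean_space) \<Rightarrow> bool" where
  "piecewise_polynomial f \<longleftrightarrow>
     (\<exists>F. finite F \<and>
       (\<forall>(A, p)\<in>F. semialgebraic A \<and> polynomial_function p \<and> (\<forall>x\<in>A. f x = p x)) \<and>
       \<Union>(fst ` F) = UNIV)"

lemma piecewise_polynomial_polynomial:
  assumes "polynomial_function p"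
  shows "piecewise_polynomial p"
  unfolding piecewise_polynomial_def
  by (rule exI[of _ "{(UNIV, p)}"]) (use assms in \<open>auto simp: semialgebraic_UNIV\<close>)

lemma piecewise_polynomial_const: "piecewise_polynomial (\<lambda>x. c)"
  by (simp add: piecewise_polynomial_polynomial)

lemma piecewise_polynomial_inner_const: "piecewise_polynomial (\<lambda>x. x \<bullet> a)"
  using real_polynomial_function_inner_const
  by (intro piecewise_polynomial_polynomial) (simp add: real_polynomial_function_eq)

text \<open>On each intersection of a piece of \<open>f\<close> with a piece of \<open>g\<close>
  both maps are polynomial, and these intersections again form a finite cover. Sums, differences,
  scalings and pairings are instances.\<close>

lemma piecewise_polynomial_binary:
  fixes op :: "'b::euclidean_space \<Rightarrow> 'c::euclidean_space \<Rightarrow> 'd::euclidean_space"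
  assumes "piecewise_polynomial (f :: 'a::euclidean_space \<Rightarrow> 'b)" "piecewise_polynomial g"
    and op: "\<And>(p :: 'a \<Rightarrow> 'b) q. polynomial_function p \<Longrightarrow> polynomial_function q \<Longrightarrow>
               polynomial_function (\<lambda>x. op (p x) (q x))"
  shows "piecewise_polynomial (\<lambda>x. op (f x) (g x))"
proof -
  obtain F where F: "finite F"
      "\<And>A p. (A, p) \<in> F \<Longrightarrow> semialgebraic A \<and> polynomial_function p \<and> (\<forall>x\<in>A. f x = p x)"
      "\<Union>(fst ` F) = UNIV"
    using assms(1) unfolding piecewise_polynomial_def by fastforce
  obtain G where G: "finite G"
      "\<And>A p. (A, p) \<in> G \<Longrightarrow> semialgebraic A \<and> polynomial_function p \<and> (\<forall>x\<in>A. g x = p x)"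
      "\<Union>(fst ` G) = UNIV"
    using assms(2) unfolding piecewise_polynomial_def by fastforce
  let ?H = "(\<lambda>((A, p), (B, q)). (A \<inter> B, \<lambda>x. op (p x) (q x))) ` (F \<times> G)"
  have "x \<in> \<Union>(fst ` ?H)" for x
  proof -
    obtain A p B q where "(A, p) \<in> F" "x \<in> A" "(B, q) \<in> G" "x \<in> B"
      using F(3) G(3) by fastforce
    then show ?thesis by force
  qed
  then have "\<Union>(fst ` ?H) = UNIV" by blast
  moreover have "\<forall>(A, p)\<in>?H. semialgebraic A \<and> polynomial_function p \<and> (\<forall>x\<in>A. op (f x) (g x) = p x)"
    using F(2) G(2) op by (force intro: semialgebraic_Int)
  moreover have "finite ?H" using F(1) G(1) by simp
  ultimately show ?thesis unfolding piecewise_polynomial_def by (intro exI[of _ ?H]) simp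
qed

lemma piecewise_polynomial_add:
  "piecewise_polynomial f \<Longrightarrow> piecewise_polynomial g \<Longrightarrow> piecewise_polynomial (\<lambda>x. f x + g x)"
  by (rule piecewise_polynomial_binary) auto

lemma piecewise_polynomial_diff:
  "piecewise_polynomial f \<Longrightarrow> piecewise_polynomial g \<Longrightarrow> piecewise_polynomial (\<lambda>x. f x - g x)"
  by (rule piecewise_polynomial_binary) auto

lemma piecewise_polynomial_scaleR:
  "piecewise_polynomial f \<Longrightarrow> piecewise_polynomial g \<Longrightarrow> piecewise_polynomial (\<lambda>x. f x *\<^sub>R g x)"
  by (rule piecewise_polynomial_binary) auto

lemma piecewise_polynomial_mult:
  fixes f g :: "'a::euclidean_space \<Rightarrow> real"
  shows "piecewise_polynomial f \<Longrightarrow> piecewise_polynomial g \<Longrightarrow> piecewise_polynomial (\<lambda>x. f x * g x)"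
  using piecewise_polynomial_scaleR[of f g] by simp

lemma polynomial_function_Pair:
  fixes p :: "'a::euclidean_space \<Rightarrow> 'b::euclidean_space" and q :: "'a \<Rightarrow> 'c::euclidean_space"
  assumes "polynomial_function p" "polynomial_function q"
  shows "polynomial_function (\<lambda>x. (p x, q x))"
  using assms
  by (simp add: polynomial_function_iff_Basis_inner[of p] polynomial_function_iff_Basis_inner[of q]
      polynomial_function_iff_Basis_inner[of "\<lambda>x. (p x, q x)"] Basis_prod_def ball_Un)

lemma piecewise_polynomial_Pair:
  "piecewise_polynomial f \<Longrightarrow> piecewise_polynomial g \<Longrightarrow> piecewise_polynomial (\<lambda>x. (f x, g x))"
  by (rule piecewise_polynomial_binary) (auto intro: polynomial_function_Pair)

lemma piecewise_polynomial_sum: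
  "finite I \<Longrightarrow> (\<And>i. i \<in> I \<Longrightarrow> piecewise_polynomial (f i)) \<Longrightarrow> piecewise_polynomial (\<lambda>x. \<Sum>i\<in>I. f i x)"
  by (induction I rule: finite_induct) (auto intro: piecewise_polynomial_const piecewise_polynomial_add)

lemma piecewise_polynomial_prod:
  fixes f :: "'i \<Rightarrow> 'a::euclidean_space \<Rightarrow> real"
  shows "finite I \<Longrightarrow> (\<And>i. i \<in> I \<Longrightarrow> piecewise_polynomial (f i)) \<Longrightarrow> piecewise_polynomial (\<lambda>x. \<Prod>i\<in>I. f i x)"
  by (induction I rule: finite_induct) (auto intro: piecewise_polynomial_const piecewise_polynomial_mult)

lemma piecewise_polynomial_power:
  fixes f :: "'a::euclidean_space \<Rightarrow> real"
  shows "piecewise_polynomial f \<Longrightarrow> piecewise_polynomial (\<lambda>x. f x ^ n)"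
  by (induction n) (auto intro: piecewise_polynomial_const piecewise_polynomial_mult)

text \<open>Each piece is split along the sign of its own polynomial, which is a semialgebraic
  condition.\<close>

lemma piecewise_polynomial_max_0:
  fixes f :: "'a::euclidean_space \<Rightarrow> real"
  assumes "piecewise_polynomial f"
  shows "piecewise_polynomial (\<lambda>x. max 0 (f x))"
proof -
  obtain F where F: "finite F"
      "\<And>A p. (A, p) \<in> F \<Longrightarrow> semialgebraic A \<and> polynomial_function p \<and> (\<forall>x\<in>A. f x = p x)"
      "\<Union>(fst ` F) = UNIV"
    using assms(1) unfolding piecewise_polynomial_def by fastforce
  let ?H = "(\<lambda>(A, p). (A \<inter> {x. p x > 0}, p)) ` F \<union> (\<lambda>(A, p). (A \<inter> - {x. p x > 0}, \<lambda>x. 0)) ` F"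
  have "x \<in> \<Union>(fst ` ?H)" for x
  proof -
    obtain A p where "(A, p) \<in> F" "x \<in> A"
      using F(3) by fastforce
    then show ?thesis by (cases "p x > 0") force+
  qed
  then have "\<Union>(fst ` ?H) = UNIV" by blast
  moreover have "\<forall>(A, p)\<in>?H. semialgebraic A \<and> polynomial_function p \<and> (\<forall>x\<in>A. max 0 (f x) = p x)"
    using F(2)
    by (auto simp flip: real_polynomial_function_eq
        intro!: semialgebraic_Int semialgebraic.gt semialgebraic.compl)
  moreover have "finite ?H" using F(1) by simp
  ultimately show ?thesis unfolding piecewise_polynomial_def by (intro exI[of _ ?H]) simp
qed

lemma piecewise_polynomial_compose_polynomial:
  assumes "piecewise_polynomial f" "polynomial_function g"
  shows "piecewise_polynomial (\<lambda>x. f (g x))"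
proof -
  obtain F where F: "finite F"
      "\<And>A p. (A, p) \<in> F \<Longrightarrow> semialgebraic A \<and> polynomial_function p \<and> (\<forall>x\<in>A. f x = p x)"
      "\<Union>(fst ` F) = UNIV"
    using assms(1) unfolding piecewise_polynomial_def by fastforce
  let ?H = "(\<lambda>(A, p). (g -` A, p \<circ> g)) ` F"
  have "x \<in> \<Union>(fst ` ?H)" for x
  proof -
    obtain A p where "(A, p) \<in> F" "g x \<in> A"
      using F(3) by fastforce
    then show ?thesis by force
  qed
  then have "\<Union>(fst ` ?H) = UNIV" by blast
  moreover have "\<forall>(A, p)\<in>?H. semialgebraic A \<and> polynomial_function p \<and> (\<forall>x\<in>A. f (g x) = p x)"
    using F(2) assms(2) by (auto intro: semialgebraic_vimage_polynomial polynomial_function_compose)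
  moreover have "finite ?H" using F(1) by simp
  ultimately show ?thesis unfolding piecewise_polynomial_def by (intro exI[of _ ?H]) simp
qed

section \<open>Preimages, graphs and composition under piecewise polynomial maps\<close>

lemma semialgebraic_vimage:
  assumes "semialgebraic S" "piecewise_polynomial g"
  shows "semialgebraic (g -` S)"
proof -
  obtain F where F: "finite F"
      "\<And>A p. (A, p) \<in> F \<Longrightarrow> semialgebraic A \<and> polynomial_function p \<and> (\<forall>x\<in>A. g x = p x)"
      "\<Union>(fst ` F) = UNIV"
    using assms(2) unfolding piecewise_polynomial_def by fastforce
  have "g -` S = (\<Union>(A, p)\<in>F. A \<inter> p -` S)"
  proof (intro equalityI subsetI)
    fix x assume "x \<in> g -` S"
    moreover obtain A p where "(A, p) \<in> F" "x \<in> A"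
      using F(3) by fastforce
    ultimately show "x \<in> (\<Union>(A, p)\<in>F. A \<inter> p -` S)" using F(2) by force
  qed (use F(2) in fastforce)
  moreover have "semialgebraic (\<Union>(A, p)\<in>F. A \<inter> p -` S)"
    using F(1,2) assms(1)
    by (intro semialgebraic_UN) (auto intro: semialgebraic_Int semialgebraic_vimage_polynomial)
  ultimately show ?thesis by simp
qed

lemma semialgebraic_less:
  fixes f g :: "'a::euclidean_space \<Rightarrow> real"
  assumes "piecewise_polynomial f" "piecewise_polynomial g"
  shows "semialgebraic {x. f x < g x}"
proof -
  have "semialgebraic ((\<lambda>x. g x - f x) -` {t. t > 0})"
    using assms by (intro semialgebraic_vimage piecewise_polynomial_diff semialgebraic.gt) auto
  then show ?thesis by (simp add: vimage_def)
qed

lemma polynomial_function_fst: "polynomial_function fst"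
  and polynomial_function_snd: "polynomial_function snd"
  by (simp_all add: polynomial_function_bounded_linear bounded_linear_fst bounded_linear_snd)

lemma in_graph_iff: "(x, y) \<in> (\<lambda>x. (x, h x)) ` A \<longleftrightarrow> x \<in> A \<and> y = h x"
  by blast

text \<open>The graph of the composition over \<open>S\<close> is the preimage of the graph of
  \<open>f\<close> under the map sending \<open>(x, y)\<close> to \<open>(g x, y)\<close>, cut down
  to the points above \<open>S\<close>. That map is piecewise polynomial, so no quantifier has to be
  eliminated.\<close>

lemma semialgebraic_on_compose:
  fixes f :: "'b::euclidean_space \<Rightarrow> 'c::euclidean_space" and g :: "'a::euclidean_space \<Rightarrow> 'b"
  assumes f: "semialgebraic_on T f" and g: "piecewise_polynomial g"
    and S: "semialgebraic S" "g ` S \<subseteq> T"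
  shows "semialgebraic_on S (\<lambda>x. f (g x))"
proof -
  have "z \<in> (\<lambda>x. (x, f (g x))) ` S \<longleftrightarrow>
      z \<in> fst -` S \<inter> (\<lambda>z. (g (fst z), snd z)) -` ((\<lambda>x. (x, f x)) ` T)" for z
    using S(2) by (cases z) (auto simp: in_graph_iff)
  then have "(\<lambda>x. (x, f (g x))) ` S =
      fst -` S \<inter> (\<lambda>z. (g (fst z), snd z)) -` ((\<lambda>x. (x, f x)) ` T)"
    by (rule set_eqI)
  moreover have "piecewise_polynomial (\<lambda>z :: 'a \<times> 'c. (g (fst z), snd z))"
    using piecewise_polynomial_compose_polynomial[OF g polynomial_function_fst]
      piecewise_polynomial_polynomial[OF polynomial_function_snd]
    by (rule piecewise_polynomial_Pair)
  then have "semialgebraic (fst -` S \<inter> (\<lambda>z. (g (fst z), snd z)) -` ((\<lambda>x. (x, f x)) ` T))"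
    using f S(1) polynomial_function_fst
    by (intro semialgebraic_Int semialgebraic_vimage semialgebraic_vimage_polynomial)
       (simp_all add: semialgebraic_on_def)
  ultimately show ?thesis
    using S(1) by (simp add: semialgebraic_on_def)
qed

text \<open>A composition with the identity as outer map: the graph of the identity is the diagonal,
  the zero set of a polynomial map.\<close>

lemma semialgebraic_on_piecewise_polynomial:
  assumes "piecewise_polynomial g" "semialgebraic S"
  shows "semialgebraic_on S g"
proof -
  have "(\<lambda>x. (x, x)) ` (UNIV :: 'b set) = (\<lambda>z. fst z - snd z) -` {0}" by auto
  also have "semialgebraic \<dots>"
    by (intro semialgebraic_vimage_polynomial semialgebraic_zero polynomial_function_diff
        polynomial_function_fst polynomial_function_snd)
  finally have "semialgebraic_on UNIV (\<lambda>x :: 'b. x)"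
    by (simp add: semialgebraic_on_def semialgebraic_UNIV)
  from semialgebraic_on_compose[OF this assms] show ?thesis by simp
qed

section \<open>Functions of class \<open>C\<^sup>\<nu>\<close>\<close>

lemma C_class_subset: "C_class n U f \<Longrightarrow> V \<subseteq> U \<Longrightarrow> C_class n V f"
  by (induction n arbitrary: f) (auto intro: continuous_on_subset)

text \<open>Because \<open>U\<close> is open, the functions agree near each of its points, so their
  derivatives agree there and the induction can pass to them.\<close>

lemma C_class_cong:
  assumes "open U" "\<And>x. x \<in> U \<Longrightarrow> f x = g x"
  shows "C_class n U f \<Longrightarrow> C_class n U g"
  using assms(2)
proof (induction n arbitrary: f g)
  case 0
  then show ?case by (metis C_class.simps(1) continuous_on_cong)
next
  case (Suc n)
  have "g differentiable at x" if "x \<in> U" for x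
    using Suc.prems assms(1) that
    by (meson C_class.simps(2) differentiable_def has_derivative_transform_within_open)
  moreover have deriv: "frechet_derivative f (at x) = frechet_derivative g (at x)" if "x \<in> U" for x
    using Suc.prems assms(1) that by (intro frechet_derivative_transform_within_open) auto
  have "C_class n U (\<lambda>x. frechet_derivative g (at x) b)" if "b \<in> Basis" for b
    by (rule Suc.IH[of "\<lambda>x. frechet_derivative f (at x) b"]) (use that Suc.prems(1) deriv in simp_all)
  ultimately show ?case by simp
qed

text \<open>The derivatives in \<open>C_class\<close> are taken at \<open>x\<close> in the whole
  space and not within \<open>U\<close>, so each order can be tested on any open set around the
  point.\<close>

lemma C_class_local:
  assumes "\<And>x. x \<in> U \<Longrightarrow> \<exists>V. open V \<and> x \<in> V \<and> C_class n V f"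
  shows "C_class n U f"
  using assms
proof (induction n arbitrary: f)
  case 0
  then have "continuous (at x) f" if "x \<in> U" for x
    using that by (metis C_class.simps(1) continuous_on_eq_continuous_at)
  then show ?case by (simp add: continuous_at_imp_continuous_on)
next
  case (Suc n)
  have "C_class n U (\<lambda>x. frechet_derivative f (at x) b)" if "b \<in> Basis" for b
    by (rule Suc.IH) (use Suc.prems that in fastforce)
  moreover have "f differentiable at x" if "x \<in> U" for x
    using Suc.prems[OF that] by auto
  ultimately show ?case by simp
qed

lemma C_class_SucD: "C_class (Suc n) U f \<Longrightarrow> C_class n U f"
proof (induction n arbitrary: f)
  case 0
  then show ?case
    by (auto intro!: continuous_at_imp_continuous_on differentiable_imp_continuous_within)
qed auto

lemma C_class_imp_continuous_on: "C_class n U f \<Longrightarrow> continuous_on U f"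
  by (induction n) (use C_class_SucD in auto)

text \<open>By uniqueness of the derivative, an explicit formula \<open>f'\<close> can stand in for
  \<open>frechet_derivative\<close>. The inductions below all apply this rule to a calculus
  formula.\<close>

lemma C_class_SucI:
  assumes "open U" "\<And>x. x \<in> U \<Longrightarrow> (f has_derivative f' x) (at x)"
    and "\<And>b. b \<in> Basis \<Longrightarrow> C_class n U (\<lambda>x. f' x b)"
  shows "C_class (Suc n) U f"
proof -
  have "f' x = frechet_derivative f (at x)" if "x \<in> U" for x
    using assms(2)[OF that] by (rule frechet_derivative_at)
  then have "C_class n U (\<lambda>x. frechet_derivative f (at x) b)" if "b \<in> Basis" for b
    by (intro C_class_cong[OF assms(1) _ assms(3)[OF that]]) simp
  then show ?thesis using assms(2) by (auto simp: differentiable_def)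
qed

lemma C_class_const: "open U \<Longrightarrow> C_class n U (\<lambda>x. c)"
proof (induction n arbitrary: c)
  case (Suc n)
  show ?case
    by (rule C_class_SucI[where f' = "\<lambda>_ _. 0"]) (use Suc in auto)
qed auto

lemma C_class_add:
  assumes "open U"
  shows "C_class n U f \<Longrightarrow> C_class n U g \<Longrightarrow> C_class n U (\<lambda>x. f x + g x)"
proof (induction n arbitrary: f g)
  case (Suc n)
  show ?case
    by (rule C_class_SucI[OF assms,
          where f' = "\<lambda>x h. frechet_derivative f (at x) h + frechet_derivative g (at x) h"])
       (use Suc in \<open>auto intro!: has_derivative_add simp flip: frechet_derivative_works\<close>)
qed (auto intro: continuous_intros)

lemma C_class_mult:
  assumes "open U"
  shows "C_class n U f \<Longrightarrow> C_class n U g \<Longrightarrow> C_class n U (\<lambda>x. f x * g x)"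
proof (induction n arbitrary: f g)
  case (Suc n)
  let ?D = "\<lambda>x h. f x * frechet_derivative g (at x) h + frechet_derivative f (at x) h * g x"
  have "((\<lambda>x. f x * g x) has_derivative ?D x) (at x)" if "x \<in> U" for x
    using Suc.prems that by (intro has_derivative_mult) (auto simp flip: frechet_derivative_works)
  moreover have "C_class n U (\<lambda>x. ?D x b)" if "b \<in> Basis" for b
  proof -
    have "C_class n U f" "C_class n U g" by (rule C_class_SucD, rule Suc.prems)+
    then have "C_class n U (\<lambda>x. f x * frechet_derivative g (at x) b)"
        "C_class n U (\<lambda>x. frechet_derivative f (at x) b * g x)"
      using Suc.prems that by (auto intro: Suc.IH)
    then show ?thesis by (rule C_class_add[OF assms])
  qed
  ultimately show ?case by (rule C_class_SucI[OF assms])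
qed (auto intro: continuous_intros)

lemma C_class_diff:
  assumes "open U" "C_class n U f" "C_class n U g"
  shows "C_class n U (\<lambda>x. f x - g x)"
  using C_class_add[OF assms(1,2) C_class_mult[OF assms(1) C_class_const[OF assms(1), of n "-1"] assms(3)]]
  by simp

lemma C_class_sum:
  assumes "open U"
  shows "finite I \<Longrightarrow> (\<And>i. i \<in> I \<Longrightarrow> C_class n U (f i)) \<Longrightarrow> C_class n U (\<lambda>x. \<Sum>i\<in>I. f i x)"
  by (induction I rule: finite_induct) (auto intro: C_class_const C_class_add assms)

lemma C_class_prod:
  assumes "open U"
  shows "finite I \<Longrightarrow> (\<And>i. i \<in> I \<Longrightarrow> C_class n U (f i)) \<Longrightarrow> C_class n U (\<lambda>x. \<Prod>i\<in>I. f i x)"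
  by (induction I rule: finite_induct) (auto intro: C_class_const C_class_mult assms)

lemma C_class_bounded_linear:
  assumes "bounded_linear f" "open U"
  shows "C_class n U f"
proof (cases n)
  case 0
  then show ?thesis
    using assms(1) by (simp add: linear_continuous_on)
next
  case (Suc m)
  have "C_class (Suc m) U f"
    by (rule C_class_SucI[OF assms(2), where f' = "\<lambda>_. f"])
       (use assms in \<open>auto intro: bounded_linear_imp_has_derivative C_class_const\<close>)
  then show ?thesis using Suc by simp
qed

text \<open>Induction with the chain rule in coordinates. The partial derivatives of
  \<open>F\<close> vary with the induction, hence \<open>F\<close> is arbitrary; \<open>g\<close>
  stays fixed and is only lowered in order.\<close>

lemma C_class_compose:
  fixes g :: "'a::euclidean_space \<Rightarrow> 'b::euclidean_space"
  assumes "open U"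
  shows "C_class n V F \<Longrightarrow> (\<And>c. c \<in> Basis \<Longrightarrow> C_class n U (\<lambda>x. g x \<bullet> c)) \<Longrightarrow> g ` U \<subseteq> V \<Longrightarrow>
    C_class n U (\<lambda>x. F (g x))"
proof (induction n arbitrary: F)
  case 0
  then have "continuous_on U g"
    by (simp add: continuous_on_componentwise[of U g])
  with 0 show ?case
    by (auto intro: continuous_on_compose2)
next
  case (Suc n)
  let ?F' = "\<lambda>x h. \<Sum>c\<in>Basis. frechet_derivative (\<lambda>x. g x \<bullet> c) (at x) h * frechet_derivative F (at (g x)) c"
  have "((\<lambda>x. F (g x)) has_derivative ?F' x) (at x)" if "x \<in> U" for x
  proof -
    have comp: "((\<lambda>x. g x \<bullet> c) has_derivative frechet_derivative (\<lambda>x. g x \<bullet> c) (at x)) (at x)"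
      if "c \<in> Basis" for c
      using Suc.prems(2)[OF that] \<open>x \<in> U\<close> by (simp flip: frechet_derivative_works)
    then have "g differentiable at x"
      by (subst differentiable_componentwise_within) (auto simp: differentiable_def)
    then have g: "(g has_derivative frechet_derivative g (at x)) (at x)"
      by (simp flip: frechet_derivative_works)
    have F: "(F has_derivative frechet_derivative F (at (g x))) (at (g x))"
      using Suc.prems(1,3) that by (auto simp flip: frechet_derivative_works)
    then interpret F': bounded_linear "frechet_derivative F (at (g x))"
      by (rule has_derivative_bounded_linear)
    have "frechet_derivative F (at (g x)) (frechet_derivative g (at x) h) = ?F' x h" for h
    proof -
      have "frechet_derivative g (at x) h \<bullet> c = frechet_derivative (\<lambda>x. g x \<bullet> c) (at x) h"
        if "c \<in> Basis" for c
        using has_derivative_unique[OF has_derivative_inner_left[OF g] comp[OF that]] by metis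
      then have "frechet_derivative g (at x) h =
          (\<Sum>c\<in>Basis. frechet_derivative (\<lambda>x. g x \<bullet> c) (at x) h *\<^sub>R c)"
        by (subst euclidean_representation[of "frechet_derivative g (at x) h", symmetric])
           (auto intro: sum.cong)
      then show ?thesis by (simp add: F'.sum F'.scaleR)
    qed
    then show ?thesis
      using has_derivative_compose[OF g F] by simp
  qed
  moreover have "C_class n U (\<lambda>x. ?F' x b)" if "b \<in> Basis" for b
  proof (intro C_class_sum C_class_mult assms finite_Basis)
    fix c :: 'b assume c: "c \<in> Basis"
    show "C_class n U (\<lambda>x. frechet_derivative (\<lambda>x. g x \<bullet> c) (at x) b)"
      using Suc.prems(2)[OF c] that by simp
    have "C_class n V (\<lambda>y. frechet_derivative F (at y) c)"
      using Suc.prems(1) c by simp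
    then show "C_class n U (\<lambda>x. frechet_derivative F (at (g x)) c)"
      using C_class_SucD[OF Suc.prems(2)] Suc.prems(3) by (rule Suc.IH)
  qed
  ultimately show ?case by (rule C_class_SucI[OF assms])
qed

text \<open>Truncated powers reproduce themselves under differentiation with exponent lowered by
  one. They are the source of all cutoffs, being piecewise polynomial and of any prescribed finite
  class.\<close>

lemma C_class_max_0_power:
  "C_class n UNIV (\<lambda>t::real. max 0 t ^ Suc n)"
proof (induction n)
  case 0
  show ?case by (auto intro!: continuous_intros)
next
  case (Suc n)
  have "((\<lambda>t. max 0 t ^ Suc (Suc n)) has_derivative (\<lambda>h. real (Suc (Suc n)) * max 0 t ^ Suc n * h)) (at t)"
    for t :: real
  proof -
    have "((\<lambda>t. max 0 t ^ Suc (Suc n)) has_real_derivative real (Suc (Suc n)) * max 0 t ^ Suc n) (at t)"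
    proof -
      consider "t < 0" | "t > 0" | "t = 0" by linarith
      then show ?thesis
      proof cases
        case 1
        have "((\<lambda>t::real. 0) has_real_derivative 0) (at t)" by simp
        then have "((\<lambda>t. max 0 t ^ Suc (Suc n)) has_real_derivative 0) (at t)"
          by (rule has_field_derivative_transform_within_open[of _ _ _ "{..<0}"]) (use 1 in auto)
        then show ?thesis using 1 by simp
      next
        case 2
        have "((\<lambda>t. t ^ Suc (Suc n)) has_real_derivative real (Suc (Suc n)) * t ^ Suc n) (at t)"
          by (rule derivative_eq_intros refl | simp)+
        then have "((\<lambda>t. max 0 t ^ Suc (Suc n)) has_real_derivative real (Suc (Suc n)) * t ^ Suc n) (at t)"
          by (rule has_field_derivative_transform_within_open[of _ _ _ "{0<..}"]) (use 2 in auto)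
        then show ?thesis using 2 by simp
      next
        case 3
        \<comment> \<open>At the corner the difference quotient equals
          \<open>max 0 h ^ Suc n\<close>, which tends to 0 because the exponent is at least
          one.\<close>
        have "((\<lambda>h. max 0 h ^ Suc n) \<longlongrightarrow> max 0 0 ^ Suc n) (at (0::real))"
          by (intro tendsto_intros)
        moreover have "max 0 h ^ Suc (Suc n) / h = max 0 h ^ Suc n" if "h \<noteq> 0" for h :: real
          using that by (cases "h > 0") auto
        ultimately have "((\<lambda>h. max 0 h ^ Suc (Suc n) / h) \<longlongrightarrow> 0) (at (0::real))"
          by (auto intro: Lim_transform_eventually simp: eventually_at_filter)
        then show ?thesis using 3 by (simp add: DERIV_def)
      qed
    qed
    then show ?thesis by (simp add: has_field_derivative_def)
  qed
  moreover have "C_class n UNIV (\<lambda>t::real. real (Suc (Suc n)) * max 0 t ^ Suc n * b)" for b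
    by (intro C_class_mult C_class_const Suc.IH open_UNIV)
  ultimately show ?case by (rule C_class_SucI[OF open_UNIV])
qed

lemma C_class_max_0_power_compose:
  assumes "open U" "C_class n U g"
  shows "C_class n U (\<lambda>x. max 0 (g x) ^ Suc n)"
  by (rule C_class_compose[OF assms(1) C_class_max_0_power]) (use assms(2) in auto)

section \<open>Functions attached to a polyhedron, and the list of simplices\<close>

text \<open>The amounts by which the finitely many half-space inequalities are violated, raised to a
  power for smoothness, are added up. The result serves as a smooth, piecewise polynomial substitute
  for the distance to \<open>S\<close>.\<close>

lemma polyhedron_eq_zero_set:
  fixes S :: "'a::euclidean_space set"
  assumes "polyhedron S"
  shows "\<exists>h. piecewise_polynomial h \<and> C_class n UNIV h \<and> (\<forall>x. h x \<ge> 0) \<and> S = {x. h x = 0}"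
proof -
  obtain F where F: "finite F" "S = \<Inter>F" "\<forall>H\<in>F. \<exists>a b. a \<noteq> 0 \<and> H = {x. a \<bullet> x \<le> b}"
    using assms unfolding polyhedron_def by blast
  then obtain a b where ab: "\<And>H. H \<in> F \<Longrightarrow> H = {x. a H \<bullet> x \<le> b H}"
    by metis
  let ?h = "\<lambda>x. \<Sum>H\<in>F. max 0 (x \<bullet> a H - b H) ^ Suc n"
  have "piecewise_polynomial ?h"
    using F(1) by (intro piecewise_polynomial_sum piecewise_polynomial_power piecewise_polynomial_max_0
        piecewise_polynomial_diff piecewise_polynomial_inner_const piecewise_polynomial_const)
  moreover have "C_class n UNIV ?h"
    using F(1) by (intro C_class_sum C_class_max_0_power_compose C_class_diff C_class_const
        C_class_bounded_linear bounded_linear_inner_left open_UNIV)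
  moreover have "?h x = 0 \<longleftrightarrow> x \<in> S" for x
  proof -
    have "?h x = 0 \<longleftrightarrow> (\<forall>H\<in>F. max 0 (x \<bullet> a H - b H) ^ Suc n = 0)"
      using F(1) by (intro sum_nonneg_eq_0_iff) auto
    also have "\<dots> \<longleftrightarrow> (\<forall>H\<in>F. a H \<bullet> x \<le> b H)"
      by (auto simp: max_def inner_commute)
    also have "\<dots> \<longleftrightarrow> x \<in> S"
      using ab by (auto simp: F(2))
    finally show ?thesis .
  qed
  moreover have "?h x \<ge> 0" for x
    by (intro sum_nonneg) auto
  ultimately show ?thesis by (intro exI[of _ ?h]) auto
qed

lemma C_class_polynomial_inner:
  assumes "polynomial_function p" "open U"
  shows "C_class n U (\<lambda>x. p x \<bullet> c)"
proof -
  have "C_class n U f" if "real_polynomial_function f" for f :: "'a \<Rightarrow> real"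
    using that assms(2)
    by induction (auto intro: C_class_bounded_linear C_class_const C_class_add C_class_mult)
  moreover have "real_polynomial_function (\<lambda>x. p x \<bullet> c)"
    using assms(1) bounded_linear_inner_left[of c]
    by (auto simp: polynomial_function_def o_def)
  ultimately show ?thesis .
qed

text \<open>After translation by a point of \<open>S\<close> the affine hull becomes a linear
  subspace \<open>L\<close>, and extending the identity of \<open>L\<close> linearly to the whole
  space gives the retraction.\<close>

lemma polynomial_retraction_affine_hull:
  fixes S :: "'a::euclidean_space set"
  assumes "S \<noteq> {}"
  shows "\<exists>\<pi>. polynomial_function \<pi> \<and> range \<pi> \<subseteq> affine hull S \<and> (\<forall>x\<in>affine hull S. \<pi> x = x)"
proof -
  obtain a where "a \<in> S" using assms by blast
  define L where "L = span {x - a |x. x \<in> S - {a}}"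
  have aff: "affine hull S = (+) a ` L"
    using affine_hull_span[OF \<open>a \<in> S\<close>] by (auto simp: L_def)
  obtain g where g: "range g \<subseteq> L" "linear g" "\<forall>v\<in>L. g v = v"
    using linear_exists_left_inverse_on[OF linear_id, of L] by (auto simp: L_def)
  have "polynomial_function (g \<circ> (\<lambda>x. x - a))"
    using g(2) by (intro polynomial_function_compose polynomial_function_diff
        polynomial_function_id polynomial_function_const) (auto intro: polynomial_function_bounded_linear
        simp: linear_conv_bounded_linear)
  then have "polynomial_function (\<lambda>x. a + g (x - a))"
    by (auto simp: o_def intro!: polynomial_function_add)
  moreover have "a + g (x - a) \<in> affine hull S" for x
    using g(1) by (auto simp: aff)
  moreover have "\<forall>x\<in>affine hull S. a + g (x - a) = x"
    using g(3) by (auto simp: aff)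
  ultimately show ?thesis by (intro exI[of _ "\<lambda>x. a + g (x - a)"]) auto
qed

text \<open>Two nested truncated powers: the inner one makes the function constant up to \<delta>/2,
  the outer one makes it vanish from \<delta> on, and both joints are of class
  \<open>n\<close>.\<close>

lemma cutoff_function:
  assumes h: "piecewise_polynomial h" "C_class n UNIV h" and "\<delta> > (0::real)"
  shows "\<exists>u. piecewise_polynomial u \<and> C_class n UNIV u \<and> (\<forall>x. 0 \<le> u x \<and> u x \<le> 1) \<and>
    (\<forall>x. h x \<le> \<delta> / 2 \<longrightarrow> u x = 1) \<and> (\<forall>x. \<delta> \<le> h x \<longrightarrow> u x = 0)"
proof -
  \<comment> \<open>This rescaling carries the transition interval from \<delta>/2 to \<delta> onto
    the interval from 0 to 1.\<close>
  define s where "s = (\<lambda>x. 2 / \<delta> * h x - 1)"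
  let ?u = "\<lambda>x. max 0 (1 - max 0 (s x) ^ Suc n) ^ Suc n"
  have "piecewise_polynomial ?u"
    unfolding s_def using h(1)
    by (intro piecewise_polynomial_power piecewise_polynomial_max_0 piecewise_polynomial_diff
        piecewise_polynomial_mult piecewise_polynomial_const)
  moreover have "C_class n UNIV ?u"
    unfolding s_def using h(2)
    by (intro C_class_max_0_power_compose C_class_diff C_class_mult C_class_const open_UNIV)
  moreover have "0 \<le> ?u x \<and> ?u x \<le> 1" for x
  proof -
    have "0 \<le> max 0 (1 - max 0 (s x) ^ Suc n)" "max 0 (1 - max 0 (s x) ^ Suc n) \<le> 1" by auto
    then show ?thesis by (meson power_le_one zero_le_power)
  qed
  moreover have "?u x = 1" if "h x \<le> \<delta> / 2" for x
  proof -
    have "s x \<le> 0" using that \<open>\<delta> > 0\<close> by (simp add: s_def field_simps)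
    then have "max 0 (s x) = 0" by simp
    then show ?thesis by simp
  qed
  moreover have "?u x = 0" if "\<delta> \<le> h x" for x
  proof -
    have "1 \<le> s x" using that \<open>\<delta> > 0\<close> by (simp add: s_def field_simps)
    then have "1 \<le> max 0 (s x) ^ Suc n" by (intro one_le_power) simp
    then show ?thesis by simp
  qed
  ultimately show ?thesis by (intro exI[of _ ?u]) blast
qed

text \<open>Outside \<open>T\<close> the function has a positive minimum on the compact set
  \<open>B - T\<close>, and every smaller \<open>d\<close> works. Phrased as an eventual property,
  finitely many smallness conditions can be met at once.\<close>

lemma eventually_sublevel_subset_open:
  fixes h :: "'a::topological_space \<Rightarrow> real"
  assumes "compact B" "continuous_on B h" "open T" "\<And>x. x \<in> B \<Longrightarrow> h x \<le> 0 \<Longrightarrow> x \<in> T"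
  shows "\<forall>\<^sub>F d in at_right 0. \<forall>x\<in>B. h x \<le> d \<longrightarrow> x \<in> T"
proof (cases "B - T = {}")
  case False
  moreover have "compact (B - T)" using assms(1,3) by (rule compact_diff)
  moreover have "continuous_on (B - T) h" using assms(2) by (rule continuous_on_subset) auto
  ultimately obtain y where y: "y \<in> B - T" "\<And>x. x \<in> B - T \<Longrightarrow> h y \<le> h x"
    by (meson continuous_attains_inf)
  then have "h y > 0" using assms(4) by force
  then have "\<forall>\<^sub>F d in at_right 0. d < h y"
    by (auto simp: eventually_at_right)
  then show ?thesis
    by (rule eventually_mono) (use y(2) in force)
qed (auto intro: always_eventually)

text \<open>The simplices are sorted by affine dimension, which strictly drops on proper faces. The
  empty face is left out, since it has no points to retract onto.\<close>

lemma simplicial_complex_enumeration: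
  fixes K :: "'a::euclidean_space set set"
  assumes "simplicial_complex K"
  obtains N :: nat and \<tau> where "\<tau> ` {..<N} = K - {{}}"
    "\<And>i j. i < N \<Longrightarrow> j < N \<Longrightarrow> \<tau> i face_of \<tau> j \<Longrightarrow> i \<le> j"
proof -
  have "finite (K - {{}})" using assms by (simp add: simplicial_complex_def)
  then obtain xs where xs: "set xs = K - {{}}" "distinct xs"
    using finite_distinct_list by blast
  define ys where "ys = sort_key aff_dim xs"
  have ys: "set ys = K - {{}}" "distinct ys" "sorted (map aff_dim ys)"
    by (simp_all add: ys_def xs)
  have mono: "i \<le> j" if ij: "i < length ys" "j < length ys" "ys ! i face_of ys ! j" for i j
  proof (rule ccontr)
    assume "\<not> i \<le> j"
    then have "aff_dim (ys ! j) \<le> aff_dim (ys ! i)"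
      using sorted_nth_mono[OF ys(3), of j i] ij by simp
    moreover have "ys ! j \<in> K" using ij(2) ys(1) nth_mem by blast
    then have "convex (ys ! j)"
      using assms by (auto simp: simplicial_complex_def intro: convex_simplex)
    ultimately have "ys ! i = ys ! j"
      using face_of_aff_dim_lt ij(3) by fastforce
    then show False
      using ij ys(2) \<open>\<not> i \<le> j\<close> by (auto simp: nth_eq_iff_index_eq)
  qed
  have "(!) ys ` {..<length ys} = K - {{}}"
    by (auto simp: set_conv_nth simp flip: ys(1))
  then show thesis using mono by (rule that)
qed

section \<open>Maps that send points locally into a single simplex\<close>

text \<open>The sum is 1 wherever some \<open>u j\<close> with \<open>j < n\<close> equals 1. This
  yields a partition of unity without division, so the weights remain piecewise polynomial.\<close>

lemma sum_telescoping_weights: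
  fixes u :: "nat \<Rightarrow> real"
  shows "(\<Sum>i<n. u i * (\<Prod>j<i. 1 - u j)) = 1 - (\<Prod>j<n. 1 - u j)"
  by (induction n) (auto simp: algebra_simps)

text \<open>
  A point is treated as belonging to the cell \<open>\<tau> i\<close> if it is within \<open>\<delta> i\<close> of it and not within
  \<open>\<delta> l / 2\<close> of a cell \<open>\<tau> l\<close> listed earlier, closeness being measured by the functions \<open>h\<close>.
  The scales \<open>\<delta>\<close> decrease so fast that the cells to which a point belongs form a chain of faces.
\<close>
lemma simplicial_complex_scales:
  fixes K :: "'a::euclidean_space set set" and \<tau> :: "nat \<Rightarrow> 'a set"
    and h :: "nat \<Rightarrow> 'a \<Rightarrow> real" and \<pi> :: "nat \<Rightarrow> 'a \<Rightarrow> 'a" and \<epsilon> :: real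
  assumes K: "simplicial_complex K"
    and \<tau>: "\<tau> ` {..<N} = K - {{}}"
      "\<And>i j. i < N \<Longrightarrow> j < N \<Longrightarrow> \<tau> i face_of \<tau> j \<Longrightarrow> i \<le> j"
    and h: "\<And>i. i < N \<Longrightarrow> continuous_on UNIV (h i)" "\<And>i x. i < N \<Longrightarrow> h i x \<ge> 0"
      "\<And>i. i < N \<Longrightarrow> \<tau> i = {x. h i x = 0}"
    and \<pi>: "\<And>i. i < N \<Longrightarrow> continuous_on UNIV (\<pi> i)" "\<And>i. i < N \<Longrightarrow> range (\<pi> i) \<subseteq> affine hull \<tau> i"
      "\<And>i x. i < N \<Longrightarrow> x \<in> affine hull \<tau> i \<Longrightarrow> \<pi> i x = x"
    and B: "compact B" and \<epsilon>: "\<epsilon> > 0"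
  obtains \<delta> :: "nat \<Rightarrow> real" where
    "\<And>i. \<delta> i > 0"
    "\<And>i l. i < N \<Longrightarrow> l < i \<Longrightarrow> \<delta> i \<le> \<delta> l"
    "\<And>i x. i < N \<Longrightarrow> x \<in> B \<Longrightarrow> h i x \<le> \<delta> i \<Longrightarrow> dist (\<pi> i x) x < \<epsilon>"
    "\<And>i x. i < N \<Longrightarrow> x \<in> B \<Longrightarrow> h i x \<le> \<delta> i \<Longrightarrow> (\<And>l. l < i \<Longrightarrow> \<delta> l / 2 \<le> h l x) \<Longrightarrow> \<pi> i x \<in> \<tau> i"
    "\<And>i j x. i < j \<Longrightarrow> j < N \<Longrightarrow> \<not> \<tau> i face_of \<tau> j \<Longrightarrow> x \<in> B \<Longrightarrow> h i x \<le> \<delta> i \<Longrightarrow> h j x \<le> \<delta> i \<Longrightarrow>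
        \<exists>l<i. h l x < \<delta> l / 2"
proof -
  \<comment> \<open>\<open>Q\<close> collects the demands on the scale \<open>d\<close> of cell
    \<open>i\<close>. It mentions only the earlier scales: even the clause on later cells
    \<open>j\<close> measures \<open>h j\<close> against \<open>d\<close>, so the scales can be
    chosen one after another.\<close>
  define Q where "Q = (\<lambda>(\<delta> :: nat \<Rightarrow> real) i d.
      (\<forall>l<i. d \<le> \<delta> l) \<and>
      (\<forall>x\<in>B. h i x \<le> d \<longrightarrow> dist (\<pi> i x) x < \<epsilon>) \<and>
      (\<forall>x\<in>B. h i x \<le> d \<longrightarrow> (\<forall>l<i. \<delta> l / 2 \<le> h l x) \<longrightarrow> \<pi> i x \<in> \<tau> i) \<and>
      (\<forall>j\<in>{i<..<N}. \<not> \<tau> i face_of \<tau> j \<longrightarrow>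
         (\<forall>x\<in>B. h i x \<le> d \<and> h j x \<le> d \<longrightarrow> (\<exists>l<i. h l x < \<delta> l / 2))))"
  \<comment> \<open>Nonempty proper faces of a cell are cells listed strictly earlier, so being near
    one of them is detected by some \<open>h l\<close> with \<open>l < i\<close>.\<close>
  have face: "\<exists>l<i. \<tau> l = F" if "F face_of \<tau> i" "F \<noteq> \<tau> i" "F \<noteq> {}" "i < N" for F i
  proof -
    have "\<tau> i \<in> K" using \<tau>(1) \<open>i < N\<close> by blast
    then have "F \<in> K"
      using K \<open>F face_of \<tau> i\<close> unfolding simplicial_complex_def by blast
    then have "F \<in> \<tau> ` {..<N}" using \<tau>(1) \<open>F \<noteq> {}\<close> by simp
    then obtain l where l: "l < N" "\<tau> l = F" by blast
    then have "l \<le> i" "l \<noteq> i" using \<tau>(2)[of l i] that by auto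
    then show ?thesis using l by (intro exI[of _ l]) simp
  qed
  have cell: "\<tau> i \<in> K" "polyhedron (\<tau> i)" if "i < N" for i
  proof -
    show "\<tau> i \<in> K" using \<tau>(1) that by blast
    then show "polyhedron (\<tau> i)"
      using K by (auto simp: simplicial_complex_def intro: simplex_imp_polyhedron)
  qed
  have sub: "continuous_on T (h i)" "continuous_on T (\<pi> i)" if "i < N" for i T
    using h(1) \<pi>(1) that continuous_on_subset by blast+
  have Q: "\<exists>d>0. Q \<delta> i d" if i: "i < N" and pos: "\<And>l. l < i \<Longrightarrow> \<delta> l > 0" for \<delta> i
  proof -
    have "\<forall>\<^sub>F d in at_right 0. d \<le> \<delta> l" if "l < i" for l
      using pos[OF that] by (auto simp: eventually_at_right intro!: exI[of _ "\<delta> l"])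
    then have ev1: "\<forall>\<^sub>F d in at_right 0. \<forall>l\<in>{..<i}. d \<le> \<delta> l"
      by (intro eventually_ball_finite) auto
    have ev2: "\<forall>\<^sub>F d in at_right 0. \<forall>x\<in>B. h i x \<le> d \<longrightarrow> x \<in> {x. dist (\<pi> i x) x < \<epsilon>}"
    proof (rule eventually_sublevel_subset_open[OF B sub(1)[OF i]])
      show "open {x. dist (\<pi> i x) x < \<epsilon>}"
        by (intro open_Collect_less continuous_intros sub i)
      show "x \<in> {x. dist (\<pi> i x) x < \<epsilon>}" if "h i x \<le> 0" for x
      proof -
        have "x \<in> \<tau> i" using that h(2)[OF i, of x] by (simp add: h(3)[OF i])
        then show ?thesis using \<pi>(3)[OF i hull_inc] \<epsilon> by simp
      qed
    qed
    \<comment> \<open>Away from the earlier cells, hence from the relative frontier, zeros of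
      \<open>h i\<close> lie in the relative interior of \<open>\<tau> i\<close>. This is open in
      the affine hull, where \<open>\<pi> i\<close> takes its values, so points with small
      \<open>h i\<close> are still sent into \<open>\<tau> i\<close>.\<close>
    have ev3: "\<forall>\<^sub>F d in at_right 0. \<forall>x\<in>B. h i x \<le> d \<longrightarrow> (\<forall>l<i. \<delta> l / 2 \<le> h l x) \<longrightarrow> \<pi> i x \<in> \<tau> i"
    proof -
      obtain T where T: "open T" "rel_interior (\<tau> i) = affine hull \<tau> i \<inter> T"
        using openin_rel_interior[of "\<tau> i"] by (auto simp: openin_open)
      let ?B = "B \<inter> (\<Inter>l\<in>{..<i}. {x. \<delta> l / 2 \<le> h l x})"
      have "compact ?B"
        using i by (intro compact_Int_closed B closed_INT ballI closed_Collect_le continuous_intros sub) auto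
      moreover have "open (\<pi> i -` T)"
        using T(1) \<pi>(1)[OF i] by (rule open_vimage)
      moreover have "x \<in> \<pi> i -` T" if x: "x \<in> ?B" "h i x \<le> 0" for x
      proof -
        have "x \<in> \<tau> i" using x(2) h(2)[OF i, of x] by (simp add: h(3)[OF i])
        moreover have "x \<notin> rel_frontier (\<tau> i)"
        proof
          assume "x \<in> rel_frontier (\<tau> i)"
          then obtain F where F: "F face_of \<tau> i" "F \<noteq> \<tau> i" "x \<in> F"
            using rel_frontier_of_polyhedron_alt[OF cell(2)[OF i]] by blast
          then obtain l where "l < i" "\<tau> l = F" using face[of F i] i by blast
          then have "h l x = 0" using F(3) h(3)[of l] i by auto
          moreover have "\<delta> l / 2 \<le> h l x" using x(1) \<open>l < i\<close> by simp
          ultimately show False using pos[OF \<open>l < i\<close>] by simp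
        qed
        ultimately have "x \<in> rel_interior (\<tau> i)"
          using closure_subset[of "\<tau> i"] by (auto simp: rel_frontier_def)
        then show ?thesis using T(2) \<pi>(3)[OF i, of x] by simp
      qed
      ultimately have "\<forall>\<^sub>F d in at_right 0. \<forall>x\<in>?B. h i x \<le> d \<longrightarrow> x \<in> \<pi> i -` T"
        using sub(1)[OF i] by (intro eventually_sublevel_subset_open)
      then show ?thesis
      proof (rule eventually_mono, intro ballI impI)
        fix d x
        assume *: "\<forall>x\<in>?B. h i x \<le> d \<longrightarrow> x \<in> \<pi> i -` T" "x \<in> B" "h i x \<le> d" "\<forall>l<i. \<delta> l / 2 \<le> h l x"
        then have "\<pi> i x \<in> rel_interior (\<tau> i)"
          using T(2) \<pi>(2)[OF i] by auto
        then show "\<pi> i x \<in> \<tau> i" using rel_interior_subset by blast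
      qed
    qed
    have ev4: "\<forall>\<^sub>F d in at_right 0. \<forall>x\<in>B. max (h i x) (h j x) \<le> d \<longrightarrow> x \<in> (\<Union>l\<in>{..<i}. {x. h l x < \<delta> l / 2})"
      if j: "i < j" "j < N" "\<not> \<tau> i face_of \<tau> j" for j
    proof (rule eventually_sublevel_subset_open[OF B])
      show "continuous_on B (\<lambda>x. max (h i x) (h j x))"
        using i j by (intro continuous_intros sub)
      show "open (\<Union>l\<in>{..<i}. {x. h l x < \<delta> l / 2})"
        using i by (intro open_UN ballI open_Collect_less continuous_intros sub) auto
      fix x assume "max (h i x) (h j x) \<le> 0"
      then have x: "x \<in> \<tau> i \<inter> \<tau> j"
        using h(2)[OF i, of x] h(2)[OF j(2), of x] by (simp add: h(3)[OF i] h(3)[OF j(2)])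
      \<comment> \<open>The intersection is a face of both cells. It is proper in
        \<open>\<tau> i\<close>, since otherwise \<open>\<tau> i\<close> would be a face of
        \<open>\<tau> j\<close>; hence it is an earlier cell on which \<open>h l\<close>
        vanishes.\<close>
      have "\<tau> i \<inter> \<tau> j face_of \<tau> i" "\<tau> j \<inter> \<tau> i face_of \<tau> j"
        using K cell(1)[OF i] cell(1)[OF j(2)] by (auto simp: simplicial_complex_def)
      then obtain l where l: "l < i" "\<tau> l = \<tau> i \<inter> \<tau> j"
        using face[of "\<tau> i \<inter> \<tau> j" i] x i j(3) by (metis empty_iff inf_commute)
      then have "h l x = 0" using x h(3)[of l] i by auto
      then have "h l x < \<delta> l / 2" using pos[OF l(1)] by simp
      then show "x \<in> (\<Union>l\<in>{..<i}. {x. h l x < \<delta> l / 2})" using l(1) by blast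
    qed
    then have "\<forall>\<^sub>F d in at_right 0. \<forall>j\<in>{j\<in>{i<..<N}. \<not> \<tau> i face_of \<tau> j}.
        \<forall>x\<in>B. max (h i x) (h j x) \<le> d \<longrightarrow> x \<in> (\<Union>l\<in>{..<i}. {x. h l x < \<delta> l / 2})"
      by (intro eventually_ball_finite ballI ev4) auto
    with ev1 ev2 ev3 have "\<forall>\<^sub>F d in at_right 0. Q \<delta> i d"
    proof eventually_elim
      case (elim d)
      then show ?case unfolding Q_def by (auto simp: Bex_def)
    qed
    then have "\<forall>\<^sub>F d in at_right 0. d > 0 \<and> Q \<delta> i d"
      by (rule eventually_conj[OF eventually_at_right_less])
    then show ?thesis
      using eventually_happens'[OF trivial_limit_at_right_real] by blast
  qed
  have "\<exists>\<delta>. \<forall>i. \<delta> i > 0 \<and> (i < N \<longrightarrow> Q \<delta> i (\<delta> i))"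
  \<comment> \<open>Recursive choice of the scales; from index \<open>N\<close> on only positivity
    is demanded, which makes \<open>\<delta>\<close> total.\<close>
  proof (rule dependent_wellorder_choice[where P = "\<lambda>\<delta> i d. d > 0 \<and> (i < N \<longrightarrow> Q \<delta> i d)"])
    fix d and \<delta> \<delta>' :: "nat \<Rightarrow> real" and i
    assume "\<And>l. l < i \<Longrightarrow> \<delta> l = \<delta>' l"
    then show "(d > 0 \<and> (i < N \<longrightarrow> Q \<delta> i d)) = (d > 0 \<and> (i < N \<longrightarrow> Q \<delta>' i d))"
      unfolding Q_def by (simp cong: conj_cong)
  next
    fix i and \<delta> :: "nat \<Rightarrow> real"
    assume "\<And>l. l < i \<Longrightarrow> \<delta> l > 0 \<and> (l < N \<longrightarrow> Q \<delta> l (\<delta> l))"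
    then show "\<exists>d. d > 0 \<and> (i < N \<longrightarrow> Q \<delta> i d)"
      using Q[of i \<delta>] zero_less_one[where 'a = real] by (cases "i < N") blast+
  qed
  then obtain \<delta> where \<delta>: "\<And>i. \<delta> i > 0" "\<And>i. i < N \<Longrightarrow> Q \<delta> i (\<delta> i)"
    by blast
  show thesis
  proof (rule that[of \<delta>])
    show "\<delta> i > 0" for i by (rule \<delta>)
    show "\<delta> i \<le> \<delta> l" if "i < N" "l < i" for i l
      using \<delta>(2)[OF that(1)] that(2) by (simp add: Q_def)
    show "dist (\<pi> i x) x < \<epsilon>" if "i < N" "x \<in> B" "h i x \<le> \<delta> i" for i x
      using \<delta>(2)[OF that(1)] that by (simp add: Q_def)
    show "\<pi> i x \<in> \<tau> i" if "i < N" "x \<in> B" "h i x \<le> \<delta> i" "\<And>l. l < i \<Longrightarrow> \<delta> l / 2 \<le> h l x" for i x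
      using \<delta>(2)[OF that(1)] that by (simp add: Q_def)
    show "\<exists>l<i. h l x < \<delta> l / 2"
      if "i < j" "j < N" "\<not> \<tau> i face_of \<tau> j" "x \<in> B" "h i x \<le> \<delta> i" "h j x \<le> \<delta> i" for i j x
      using \<delta>(2)[of i] that by (simp add: Q_def)
  qed
qed

text \<open>Both conclusions on the values of \<open>\<iota>\<close> come from convexity:
  \<open>\<iota> x\<close> is a convex combination of points \<open>\<pi> i x\<close>, which all lie
  in the ball around \<open>x\<close> and, locally, in one common simplex.\<close>

lemma local_simplex_approximation:
  fixes K :: "'a::euclidean_space set set" and \<epsilon> :: real
  assumes K: "simplicial_complex K" and \<epsilon>: "\<epsilon> > 0"
  obtains \<iota> W where "open W" "semialgebraic W" "\<Union>K \<subseteq> W" "piecewise_polynomial \<iota>"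
    "\<And>b. C_class n UNIV (\<lambda>x. \<iota> x \<bullet> b)"
    "\<And>x. x \<in> W \<Longrightarrow> \<exists>V \<sigma>. open V \<and> x \<in> V \<and> V \<subseteq> W \<and> \<sigma> \<in> K \<and> \<iota> ` V \<subseteq> \<sigma>"
    "\<And>x. x \<in> W \<Longrightarrow> dist (\<iota> x) x < \<epsilon>"
proof -
  obtain N :: nat and \<tau> where \<tau>: "\<tau> ` {..<N} = K - {{}}"
      "\<And>i j. i < N \<Longrightarrow> j < N \<Longrightarrow> \<tau> i face_of \<tau> j \<Longrightarrow> i \<le> j"
    using simplicial_complex_enumeration[OF K] by metis
  have cell: "\<tau> i \<in> K" "\<tau> i \<noteq> {}" "polytope (\<tau> i)" if "i < N" for i
  proof -
    have "\<tau> i \<in> K - {{}}" using \<tau>(1) that by blast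
    then show "\<tau> i \<in> K" "\<tau> i \<noteq> {}" by auto
    then show "polytope (\<tau> i)"
      using K by (auto simp: simplicial_complex_def intro: simplex_imp_polytope)
  qed
  have "\<forall>i\<in>{..<N}. \<exists>h. piecewise_polynomial h \<and> C_class n UNIV h \<and> (\<forall>x. h x \<ge> 0) \<and> \<tau> i = {x. h x = 0}"
    using polyhedron_eq_zero_set polytope_imp_polyhedron cell(3) by blast
  then obtain h where h': "\<forall>i\<in>{..<N}. piecewise_polynomial (h i) \<and> C_class n UNIV (h i) \<and>
      (\<forall>x. h i x \<ge> 0) \<and> \<tau> i = {x. h i x = 0}"
    by (rule bchoice[THEN exE])
  then have h: "piecewise_polynomial (h i)" "C_class n UNIV (h i)" "h i x \<ge> 0" "\<tau> i = {x. h i x = 0}"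
    if "i < N" for i x
    using that by auto
  have cont_h: "continuous_on S (h i)" if "i < N" for i S
    using C_class_imp_continuous_on[OF h(2)[OF that]] by (rule continuous_on_subset) simp
  have "\<forall>i\<in>{..<N}. \<exists>\<pi>. polynomial_function \<pi> \<and> range \<pi> \<subseteq> affine hull \<tau> i \<and> (\<forall>x\<in>affine hull \<tau> i. \<pi> x = x)"
    using polynomial_retraction_affine_hull[OF cell(2)] by simp
  then obtain \<pi> where \<pi>': "\<forall>i\<in>{..<N}. polynomial_function (\<pi> i) \<and> range (\<pi> i) \<subseteq> affine hull \<tau> i \<and>
      (\<forall>x\<in>affine hull \<tau> i. \<pi> i x = x)"
    by (rule bchoice[THEN exE])
  then have \<pi>: "polynomial_function (\<pi> i)" "range (\<pi> i) \<subseteq> affine hull \<tau> i"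
      "x \<in> affine hull \<tau> i \<Longrightarrow> \<pi> i x = x"
    if "i < N" for i x
    using that by auto
  have "bounded (\<Union>i<N. \<tau> i)"
    by (intro bounded_UN ballI) (auto intro: polytope_imp_bounded cell)
  \<comment> \<open>An open box confines \<open>W\<close> and keeps it semialgebraic; the closed box
    \<open>B\<close> supplies the compactness needed for the scales.\<close>
  then obtain a where a: "(\<Union>i<N. \<tau> i) \<subseteq> box (- a) a"
    by (rule bounded_subset_box_symmetric)
  define B where "B = cbox (- a) a"
  have "compact B" by (simp add: B_def compact_cbox)
  obtain \<delta> :: "nat \<Rightarrow> real" where
    \<delta>: "\<And>i. \<delta> i > 0"
      "\<And>i l. i < N \<Longrightarrow> l < i \<Longrightarrow> \<delta> i \<le> \<delta> l"
    and near: "\<And>i x. i < N \<Longrightarrow> x \<in> B \<Longrightarrow> h i x \<le> \<delta> i \<Longrightarrow> dist (\<pi> i x) x < \<epsilon>"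
    and into: "\<And>i x. i < N \<Longrightarrow> x \<in> B \<Longrightarrow> h i x \<le> \<delta> i \<Longrightarrow> (\<And>l. l < i \<Longrightarrow> \<delta> l / 2 \<le> h l x) \<Longrightarrow> \<pi> i x \<in> \<tau> i"
    and chain: "\<And>i j x. i < j \<Longrightarrow> j < N \<Longrightarrow> \<not> \<tau> i face_of \<tau> j \<Longrightarrow> x \<in> B \<Longrightarrow> h i x \<le> \<delta> i \<Longrightarrow> h j x \<le> \<delta> i \<Longrightarrow>
        \<exists>l<i. h l x < \<delta> l / 2"
    by (rule simplicial_complex_scales[OF K \<tau> cont_h h(3,4) _ \<pi>(2,3) \<open>compact B\<close> \<epsilon>])
       (auto intro: continuous_on_polymonial_function \<pi>(1))
  have "\<forall>i\<in>{..<N}. \<exists>u. piecewise_polynomial u \<and> C_class n UNIV u \<and> (\<forall>x. 0 \<le> u x \<and> u x \<le> 1) \<and>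
      (\<forall>x. h i x \<le> \<delta> i / 2 \<longrightarrow> u x = 1) \<and> (\<forall>x. \<delta> i \<le> h i x \<longrightarrow> u x = 0)"
    using cutoff_function[OF h(1,2) \<delta>(1)] by simp
  then obtain u where u': "\<forall>i\<in>{..<N}. piecewise_polynomial (u i) \<and> C_class n UNIV (u i) \<and>
      (\<forall>x. 0 \<le> u i x \<and> u i x \<le> 1) \<and>
      (\<forall>x. h i x \<le> \<delta> i / 2 \<longrightarrow> u i x = 1) \<and> (\<forall>x. \<delta> i \<le> h i x \<longrightarrow> u i x = 0)"
    by (rule bchoice[THEN exE])
  then have u: "piecewise_polynomial (u i)" "C_class n UNIV (u i)" "0 \<le> u i x" "u i x \<le> 1"
      "h i x \<le> \<delta> i / 2 \<Longrightarrow> u i x = 1" "\<delta> i \<le> h i x \<Longrightarrow> u i x = 0"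
    if "i < N" for i x
    using that by auto
  define w where "w = (\<lambda>i x. u i x * (\<Prod>j<i. 1 - u j x))"
  define \<iota> where "\<iota> = (\<lambda>x. \<Sum>i<N. w i x *\<^sub>R \<pi> i x)"
  \<comment> \<open>The bound \<delta>/2 places each point of \<open>W\<close> where some cutoff
    equals 1, so the weights sum to 1 there.\<close>
  define W where "W = box (- a) a \<inter> (\<Union>i<N. {x. h i x < \<delta> i / 2})"
  \<comment> \<open>\<open>I x\<close> contains every index whose weight is nonzero at
    \<open>x\<close>. Its inequalities are not strict, so being outside it is an open condition and
    \<open>I\<close> cannot grow near a given point.\<close>
  define I where "I = (\<lambda>x. {i. i < N \<and> h i x \<le> \<delta> i \<and> (\<forall>l<i. \<delta> l / 2 \<le> h l x)})"
  have fin: "finite (I x)" for x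
    by (simp add: I_def)
  have w: "piecewise_polynomial (w i)" "C_class n UNIV (w i)" "0 \<le> w i x" if "i < N" for i x
  proof -
    show "piecewise_polynomial (w i)"
      unfolding w_def using that
      by (intro piecewise_polynomial_mult piecewise_polynomial_prod piecewise_polynomial_diff
          piecewise_polynomial_const u) auto
    show "C_class n UNIV (w i)"
      unfolding w_def using that
      by (intro C_class_mult C_class_prod C_class_diff C_class_const u open_UNIV) auto
    show "0 \<le> w i x"
      unfolding w_def using that by (intro mult_nonneg_nonneg prod_nonneg) (auto simp: u)
  qed
  have w_zero: "w i x = 0" if i: "i < N" and out: "i \<notin> I x" for i x
  proof -
    have "\<delta> i \<le> h i x \<or> (\<exists>l<i. h l x \<le> \<delta> l / 2)"
      using i out unfolding I_def mem_Collect_eq by (meson linear)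
    then consider "\<delta> i \<le> h i x" | l where "l < i" "h l x \<le> \<delta> l / 2"
      by blast
    then show ?thesis
    proof cases
      case 1
      then show ?thesis using u(6)[OF i] by (simp add: w_def)
    next
      case 2
      then have "1 - u l x = 0" using u(5)[of l x] i by simp
      then have "(\<Prod>j<i. 1 - u j x) = 0" using 2(1) by (intro prod_zero) auto
      then show ?thesis by (simp add: w_def)
    qed
  qed
  have not_I: "i \<notin> I x \<longleftrightarrow> \<delta> i < h i x \<or> (\<exists>l<i. h l x < \<delta> l / 2)" if "i < N" for i x
    using that unfolding I_def mem_Collect_eq by (metis not_le)
  have I_sub: "I x \<subseteq> {..<N}" for x by (auto simp: I_def)
  have w_sum: "(\<Sum>i\<in>I x. w i x) = 1" if x: "x \<in> W" for x
  proof -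
    obtain i where "i < N" "h i x < \<delta> i / 2" using x by (auto simp: W_def)
    then have "1 - u i x = 0" using u(5)[of i x] by simp
    then have "(\<Prod>j<N. 1 - u j x) = 0" using \<open>i < N\<close> by (intro prod_zero) auto
    then have "(\<Sum>i<N. w i x) = 1"
      by (simp add: w_def sum_telescoping_weights)
    moreover have "(\<Sum>i\<in>I x. w i x) = (\<Sum>i<N. w i x)"
      by (rule sum.mono_neutral_left) (use I_sub w_zero in auto)
    ultimately show ?thesis by simp
  qed
  have \<iota>_in: "\<iota> x \<in> C" if "x \<in> W" "convex C" "\<And>i. i \<in> I x \<Longrightarrow> \<pi> i x \<in> C" for x C
  proof -
    have "\<iota> x = (\<Sum>i\<in>I x. w i x *\<^sub>R \<pi> i x)"
      unfolding \<iota>_def by (rule sum.mono_neutral_right) (use I_sub w_zero in auto)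
    also have "\<dots> \<in> C"
      using I_sub w(3) by (intro convex_sum fin that w_sum) auto
    finally show ?thesis .
  qed
  have WB: "x \<in> B" if "x \<in> W" for x
    using that box_subset_cbox[of "- a" a] by (auto simp: W_def B_def)
  have open_h: "open {x. h i x < c}" "open {x. c < h i x}" if "i < N" for i c
    by (auto intro!: open_Collect_less continuous_on_const cont_h that)
  show thesis
  proof (rule that[of W \<iota>])
    show "open W"
      unfolding W_def by (intro open_Int open_box open_UN ballI open_h) auto
    show "semialgebraic W"
      unfolding W_def
      by (intro semialgebraic_Int semialgebraic_box semialgebraic_UN semialgebraic_less
          piecewise_polynomial_const h) auto
    show "\<Union>K \<subseteq> W"
    proof
      fix x assume "x \<in> \<Union>K"
      then have "x \<in> \<Union>(\<tau> ` {..<N})" unfolding \<tau>(1) by auto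
      then obtain i where i: "i < N" "x \<in> \<tau> i" by blast
      then have "h i x < \<delta> i / 2" using h(4)[of i] \<delta>(1)[of i] by auto
      then show "x \<in> W" using a i by (auto simp: W_def)
    qed
    show "piecewise_polynomial \<iota>"
      unfolding \<iota>_def using w(1) \<pi>(1)
      by (intro piecewise_polynomial_sum piecewise_polynomial_scaleR) (auto intro: piecewise_polynomial_polynomial)
    show "C_class n UNIV (\<lambda>x. \<iota> x \<bullet> b)" for b
    proof -
      have "C_class n UNIV (\<lambda>x. \<Sum>i<N. w i x * (\<pi> i x \<bullet> b))"
        using w(2) \<pi>(1) by (intro C_class_sum C_class_mult C_class_polynomial_inner) auto
      then show ?thesis by (simp add: \<iota>_def inner_sum_left)
    qed
    show "dist (\<iota> x) x < \<epsilon>" if "x \<in> W" for x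
    proof -
      have "\<iota> x \<in> ball x \<epsilon>"
        using near WB[OF that] by (intro \<iota>_in[OF that]) (auto simp: I_def dist_commute)
      then show ?thesis by (simp add: dist_commute)
    qed
    show "\<exists>V \<sigma>. open V \<and> x \<in> V \<and> V \<subseteq> W \<and> \<sigma> \<in> K \<and> \<iota> ` V \<subseteq> \<sigma>" if x: "x \<in> W" for x
    proof -
      \<comment> \<open>Every index missing from \<open>I x\<close> stays excluded throughout
        \<open>V\<close>, by the strict inequalities that exclude it at \<open>x\<close>.\<close>
      define V where "V = W \<inter> (\<Inter>i\<in>{..<N} - I x. {y. \<delta> i < h i y} \<union> (\<Union>l<i. {y. h l y < \<delta> l / 2}))"
      have "open V"
        unfolding V_def using \<open>open W\<close> by (intro open_Int open_INT open_Un open_UN ballI open_h) auto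
      have "x \<in> V"
        using x by (auto simp: V_def not_I)
      have IV: "I y \<subseteq> I x" if y: "y \<in> V" for y
      proof
        fix i assume i: "i \<in> I y"
        then have "i < N" by (simp add: I_def)
        show "i \<in> I x"
        proof (rule ccontr)
          assume "i \<notin> I x"
          then have "\<delta> i < h i y \<or> (\<exists>l<i. h l y < \<delta> l / 2)"
            using y \<open>i < N\<close> by (auto simp: V_def)
          then show False using not_I[OF \<open>i < N\<close>] i by blast
        qed
      qed
      have "I x \<noteq> {}" using w_sum[OF x] by auto
      define m where "m = Max (I x)"
      have m: "m \<in> I x" "\<And>i. i \<in> I x \<Longrightarrow> i \<le> m"
        using fin \<open>I x \<noteq> {}\<close> by (auto simp: m_def)
      then have "m < N" by (simp add: I_def)
      \<comment> \<open>For \<open>i < m\<close> in \<open>I x\<close>, decreasing scales bring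
        \<open>h m x\<close> below \<open>\<delta> i\<close>. If \<open>\<tau> i\<close> were not a
        face of \<open>\<tau> m\<close>, then \<open>chain\<close> would put \<open>x\<close> too
        near an earlier cell, against membership of \<open>i\<close> in \<open>I x\<close>.\<close>
      have sub: "\<tau> i \<subseteq> \<tau> m" if "i \<in> I x" for i
      proof (cases "i = m")
        case False
        with m that have "i < m" by (simp add: le_neq_implies_less)
        have "h m x \<le> \<delta> i"
          using m(1) \<delta>(2)[OF \<open>m < N\<close> \<open>i < m\<close>] by (simp add: I_def)
        then have "\<tau> i face_of \<tau> m"
          using chain[OF \<open>i < m\<close> \<open>m < N\<close> _ WB[OF x]] that by (force simp: I_def)
        then show ?thesis by (rule face_of_imp_subset)
      qed simp
      have "\<iota> y \<in> \<tau> m" if "y \<in> V" for y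
      proof (rule \<iota>_in)
        show "y \<in> W" using that by (simp add: V_def)
        show "convex (\<tau> m)" using cell(3) \<open>m < N\<close> polytope_imp_convex by blast
        show "\<pi> i y \<in> \<tau> m" if "i \<in> I y" for i
        proof -
          have "\<pi> i y \<in> \<tau> i" using that WB[OF \<open>y \<in> W\<close>] by (intro into) (auto simp: I_def)
          then show ?thesis using sub IV[OF \<open>y \<in> V\<close>] that by blast
        qed
      qed
      then show ?thesis
        using \<open>open V\<close> \<open>x \<in> V\<close> cell(1)[OF \<open>m < N\<close>]
        by (intro exI[of _ V] exI[of _ "\<tau> m"]) (auto simp: V_def)
    qed
  qed
qed

section \<open>Composition with the given functions, and the sequence of maps\<close>

lemma semialgebraic_polyhedron:
  fixes S :: "'a::euclidean_space set"
  assumes "polyhedron S"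
  shows "semialgebraic S"
proof -
  obtain h where "piecewise_polynomial h" "S = {x. h x = (0::real)}"
    using polyhedron_eq_zero_set[OF assms, of 0] by auto
  then show ?thesis
    using semialgebraic_vimage[OF semialgebraic_zero, of h] by (simp add: vimage_def)
qed

text \<open>The extensions \<open>F\<close> chosen for different simplices may disagree, so they
  serve only for local smoothness. Semialgebraicity is taken from the graph of \<open>f\<close> over
  the whole polyhedron.\<close>

lemma compose_in_S_open:
  fixes \<iota> :: "'a::euclidean_space \<Rightarrow> 'a" and f :: "'a \<Rightarrow> real"
  assumes W: "open W" "semialgebraic W"
    and \<iota>: "piecewise_polynomial \<iota>" "\<And>b. C_class \<nu> UNIV (\<lambda>x. \<iota> x \<bullet> b)"
    and loc: "\<And>x. x \<in> W \<Longrightarrow> \<exists>V \<sigma>. open V \<and> x \<in> V \<and> V \<subseteq> W \<and> \<sigma> \<in> K \<and> \<iota> ` V \<subseteq> \<sigma>"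
    and f: "semialgebraic_on (\<Union>K) f" "\<And>\<sigma>. \<sigma> \<in> K \<Longrightarrow> f \<in> S_fun \<nu> \<sigma>"
  shows "(\<lambda>x. f (\<iota> x)) \<in> S_open \<nu> W"
proof -
  have "\<iota> ` W \<subseteq> \<Union>K"
    using loc by blast
  then have "semialgebraic_on W (\<lambda>x. f (\<iota> x))"
    by (rule semialgebraic_on_compose[OF f(1) \<iota>(1) W(2)])
  moreover have "C_class \<nu> W (\<lambda>x. f (\<iota> x))"
  proof (rule C_class_local)
    fix x assume "x \<in> W"
    then obtain V \<sigma> where V: "open V" "x \<in> V" "\<sigma> \<in> K" "\<iota> ` V \<subseteq> \<sigma>"
      using loc by blast
    then obtain U F where F: "\<sigma> \<subseteq> U" "C_class \<nu> U F" "\<forall>y\<in>\<sigma>. F y = f y"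
      using f(2)[of \<sigma>] by (auto simp: S_fun_def S_open_def)
    have "C_class \<nu> V (\<lambda>y. F (\<iota> y))"
      by (rule C_class_compose[OF V(1) F(2)]) (use V(4) F(1) C_class_subset[OF \<iota>(2)] in auto)
    then have "C_class \<nu> V (\<lambda>y. f (\<iota> y))"
      by (rule C_class_cong[OF V(1), rotated]) (use V(4) F(3) in auto)
    with V show "\<exists>V. open V \<and> x \<in> V \<and> C_class \<nu> V (\<lambda>x. f (\<iota> x))" by blast
  qed
  ultimately show ?thesis by (simp add: S_open_def)
qed

theorem corollary10:
  fixes K :: "(real ^ 'p) set set" and P :: "(real ^ 'p) set"
  assumes "simplicial_complex K"
    and "P = \<Union>K"
  shows "\<forall>\<nu>\<ge>1. \<exists>\<iota> :: nat \<Rightarrow> real ^ 'p \<Rightarrow> real ^ 'p.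
           (\<forall>n. \<iota> n \<in> S_map \<nu> P P) \<and>
           (\<forall>f :: real ^ 'p \<Rightarrow> real.
              f \<in> S0 P UNIV \<and> (\<forall>\<sigma>\<in>K. f \<in> S_fun \<nu> \<sigma>) \<longrightarrow>
              (\<forall>n. f \<circ> \<iota> n \<in> S_fun \<nu> P) \<and>
              converges_S0 P UNIV (\<lambda>n. f \<circ> \<iota> n) f) \<and>
           converges_S0 P P \<iota> id"
proof (intro allI impI)
  fix \<nu> :: nat
  have K: "finite K" "\<And>\<sigma>. \<sigma> \<in> K \<Longrightarrow> polytope \<sigma>"
    using assms(1) by (auto simp: simplicial_complex_def intro: simplex_imp_polytope)
  then have "compact P"
    unfolding assms(2) by (intro compact_Union polytope_imp_compact)
  have "semialgebraic P"
    using semialgebraic_UN[OF K(1), of "\<lambda>\<sigma>. \<sigma>"] K(2)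
    by (simp add: assms(2) semialgebraic_polyhedron polytope_imp_polyhedron)
  have "\<exists>\<iota> W. open W \<and> semialgebraic W \<and> P \<subseteq> W \<and> piecewise_polynomial \<iota> \<and>
      (\<forall>b. C_class \<nu> UNIV (\<lambda>x. \<iota> x \<bullet> b)) \<and>
      (\<forall>x\<in>W. \<exists>V \<sigma>. open V \<and> x \<in> V \<and> V \<subseteq> W \<and> \<sigma> \<in> K \<and> \<iota> ` V \<subseteq> \<sigma>) \<and>
      (\<forall>x\<in>W. dist (\<iota> x) x < inverse (real (Suc n)))" for n
  proof -
    \<comment> \<open>The n-th map is built with tolerance 1/(n+1), which is positive also for
      \<open>n = 0\<close>.\<close>
    have "inverse (real (Suc n)) > 0" by simp
    from local_simplex_approximation[OF assms(1) this] obtain \<iota> W where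
      "open W" "semialgebraic W" "\<Union>K \<subseteq> W" "piecewise_polynomial \<iota>"
      "\<And>b. C_class \<nu> UNIV (\<lambda>x. \<iota> x \<bullet> b)"
      "\<And>x. x \<in> W \<Longrightarrow> \<exists>V \<sigma>. open V \<and> x \<in> V \<and> V \<subseteq> W \<and> \<sigma> \<in> K \<and> \<iota> ` V \<subseteq> \<sigma>"
      "\<And>x. x \<in> W \<Longrightarrow> dist (\<iota> x) x < inverse (real (Suc n))" by metis
    then show ?thesis
      by (intro exI[of _ \<iota>] exI[of _ W]) (simp add: assms(2))
  qed
  then obtain \<iota> W where "\<forall>n. open (W n) \<and> semialgebraic (W n) \<and> P \<subseteq> W n \<and> piecewise_polynomial (\<iota> n) \<and>
      (\<forall>b. C_class \<nu> UNIV (\<lambda>x. \<iota> n x \<bullet> b)) \<and>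
      (\<forall>x\<in>W n. \<exists>V \<sigma>. open V \<and> x \<in> V \<and> V \<subseteq> W n \<and> \<sigma> \<in> K \<and> \<iota> n ` V \<subseteq> \<sigma>) \<and>
      (\<forall>x\<in>W n. dist (\<iota> n x) x < inverse (real (Suc n)))"
    by metis
  then have W: "open (W n)" "semialgebraic (W n)" "P \<subseteq> W n"
    and \<iota>: "piecewise_polynomial (\<iota> n)" "\<And>b. C_class \<nu> UNIV (\<lambda>x. \<iota> n x \<bullet> b)"
    and loc: "\<And>x. x \<in> W n \<Longrightarrow> \<exists>V \<sigma>. open V \<and> x \<in> V \<and> V \<subseteq> W n \<and> \<sigma> \<in> K \<and> \<iota> n ` V \<subseteq> \<sigma>"
    and near: "\<And>x. x \<in> W n \<Longrightarrow> dist (\<iota> n x) x < inverse (real (Suc n))" for n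
    by blast+
  have into: "\<iota> n ` P \<subseteq> P" for n
  proof (rule image_subsetI)
    fix x assume "x \<in> P"
    then have "x \<in> W n" using W(3) by blast
    then show "\<iota> n x \<in> P" using loc[of x n] unfolding assms(2) by blast
  qed
  have map: "\<iota> n \<in> S_map \<nu> P P" for n
  proof -
    have "(\<lambda>x. \<iota> n x \<bullet> b) \<in> S_fun \<nu> P" for b
    proof -
      have "piecewise_polynomial (\<lambda>x. \<iota> n x \<bullet> b)"
        \<comment> \<open>A unary operation treated as a binary one that ignores its second
          argument, hence the doubled fact.\<close>
        using \<iota>(1) \<iota>(1)
        by (rule piecewise_polynomial_binary[where op = "\<lambda>y _. y \<bullet> b"]) auto
      then have "(\<lambda>x. \<iota> n x \<bullet> b) \<in> S_open \<nu> (W n)"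
        using W(2) C_class_subset[OF \<iota>(2)]
        by (auto simp: S_open_def intro: semialgebraic_on_piecewise_polynomial)
      then show ?thesis
        using W unfolding S_fun_def by blast
    qed
    then show ?thesis using into by (simp add: S_map_def)
  qed
  have cont: "continuous_on P (\<iota> n)" for n
    using C_class_imp_continuous_on[OF \<iota>(2)[of n]]
    by (subst continuous_on_componentwise) (auto intro: continuous_on_subset)
  have lim: "uniform_limit P \<iota> id sequentially"
  proof (rule uniform_limitI)
    fix e :: real assume "e > 0"
    then have "\<forall>\<^sub>F n in sequentially. inverse (real (Suc n)) < e"
      by (rule order_tendstoD(2)[OF LIMSEQ_inverse_real_of_nat])
    then show "\<forall>\<^sub>F n in sequentially. \<forall>x\<in>P. dist (\<iota> n x) (id x) < e"
    proof (rule eventually_mono, intro ballI)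
      fix n x assume "inverse (real (Suc n)) < e" "x \<in> P"
      then show "dist (\<iota> n x) (id x) < e"
        using near[of x n] W(3)[of n] by auto
    qed
  qed
  have id: "semialgebraic_on P (\<lambda>x. x)"
    using \<open>semialgebraic P\<close> piecewise_polynomial_polynomial[OF polynomial_function_id]
    by (intro semialgebraic_on_piecewise_polynomial)
  have conv: "converges_S0 P P \<iota> id"
    using into cont lim id \<iota>(1) \<open>semialgebraic P\<close>
    by (auto simp: converges_S0_def S0_def id_def intro: semialgebraic_on_piecewise_polynomial)
  have "(\<forall>n. f \<circ> \<iota> n \<in> S_fun \<nu> P) \<and> converges_S0 P UNIV (\<lambda>n. f \<circ> \<iota> n) f"
    if f: "f \<in> S0 P UNIV" "\<forall>\<sigma>\<in>K. f \<in> S_fun \<nu> \<sigma>" for f :: "real ^ 'p \<Rightarrow> real"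
  proof
    have fc: "continuous_on P f" and fs: "semialgebraic_on P f"
      using f(1) by (auto simp: S0_def)
    show "\<forall>n. f \<circ> \<iota> n \<in> S_fun \<nu> P"
    proof
      fix n
      have "(\<lambda>x. f (\<iota> n x)) \<in> S_open \<nu> (W n)"
        using fs f(2) by (intro compose_in_S_open[OF W(1,2) \<iota> loc]) (auto simp: assms(2))
      then show "f \<circ> \<iota> n \<in> S_fun \<nu> P"
        unfolding S_fun_def o_def using W by blast
    qed
    have "f \<circ> \<iota> n \<in> S0 P UNIV" for n
      using continuous_on_compose2[OF fc cont into]
        semialgebraic_on_compose[OF fs \<iota>(1) \<open>semialgebraic P\<close> into]
      by (simp add: S0_def o_def)
    moreover have "uniform_limit P (\<lambda>n. f \<circ> \<iota> n) f sequentially"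
    proof (rule uniform_limitI)
      fix e :: real assume "e > 0"
      \<comment> \<open>Uniform continuity of \<open>f\<close> on the compact set \<open>P\<close>
        carries uniform convergence over from \<open>\<iota>\<close> to the compositions; it applies
        because \<open>\<iota> n\<close> maps \<open>P\<close> into \<open>P\<close>.\<close>
      then obtain d where d: "d > 0" "\<And>x y. x \<in> P \<Longrightarrow> y \<in> P \<Longrightarrow> dist y x < d \<Longrightarrow> dist (f y) (f x) < e"
        using compact_uniformly_continuous[OF fc \<open>compact P\<close>] unfolding uniformly_continuous_on_def
        by metis
      from uniform_limitD[OF lim d(1)]
      show "\<forall>\<^sub>F n in sequentially. \<forall>x\<in>P. dist ((f \<circ> \<iota> n) x) (f x) < e"
      proof (rule eventually_mono, intro ballI)
        fix n x assume "\<forall>x\<in>P. dist (\<iota> n x) (id x) < d" "x \<in> P"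
        then show "dist ((f \<circ> \<iota> n) x) (f x) < e"
          using d(2)[of x "\<iota> n x"] into[of n] by auto
      qed
    qed
    ultimately show "converges_S0 P UNIV (\<lambda>n. f \<circ> \<iota> n) f"
      using f(1) by (simp add: converges_S0_def)
  qed
  then show "\<exists>\<iota>. (\<forall>n. \<iota> n \<in> S_map \<nu> P P) \<and>
      (\<forall>f :: real ^ 'p \<Rightarrow> real. f \<in> S0 P UNIV \<and> (\<forall>\<sigma>\<in>K. f \<in> S_fun \<nu> \<sigma>) \<longrightarrow>
        (\<forall>n. f \<circ> \<iota> n \<in> S_fun \<nu> P) \<and> converges_S0 P UNIV (\<lambda>n. f \<circ> \<iota> n) f) \<and>
      converges_S0 P P \<iota> id"
    using map conv by (intro exI[of _ \<iota>]) blast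
qed

end
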